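(* Fix integers $b\geq 2$ and $N\geq 1$, and define \[ K := \Big\lceil 1 + \log_\varphi(2b^N)\Big\rceil, \qquad n_* := \max\{n\geq 0:\; F_n \leq b^N-1\}. \] Then for every integer $m\geq n_*+K+1$ there is no base-$b$ step appending at most $N$ digits from $F_m$ to a Fibonacci number; that is, there do not exist integers $n\geq 0$, $t$ with $1\leq t\leq N$, and $r$ with $0\leq r<b^t$ such that $F_n = b^t F_m + r$. Consequently, any at-most-$N$-digit-appending walk along the Fibonacci numbers in base $b$ has at most $L$ steps, where \[ L \leq n_* + K \leq 2N\log_\varphi b + \log_\varphi 2 + 4 . \] In particular $L = O(N\log_\varphi b)$ uniformly in the starting term.
   Context: $(F_n)_{n\geq 0}$ denotes the Fibonacci sequence: $F_0=0$, $F_1=1$, $F_{n+1}=F_n+F_{n-1}$. $\varphi=\frac{1+\sqrt5}{2}$. An at-most-$N$-digit-appending walk along the Fibonacci sequence in base $b$ is a finite or infinite sequence $M_0, M_1, M_2,\dots$ with $M_0 = F_m$ a Fibonacci number, such that each $M_j$ is a Fibonacci number and for each step $M_{j+1} = b^t M_j + r$ for some integers $1\leq t\leq N$ and $0\leq r<b^t$ (i.e. between $1$ and $N$ base-$b$ digits, leading zeros allowed, are appended on the right). The number of steps of the walk is the number of such transitions.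
   Formalization: The bounds on L are stated only for walks that never make the step from 0 to 0 (appending zeros to F_0 = 0); without this the constant walk 0, 0, 0, … is infinite and the bound fails. Walks starting at a positive Fibonacci number are all covered. *)

theory Defs
  imports Complex_Main "HOL-Number_Theory.Fib" "HOL-Library.Extended_Nat"
begin

definition phi :: real where
  "phi = (1 + sqrt 5) / 2"

definition append_step :: "nat \<Rightarrow> nat \<Rightarrow> nat \<Rightarrow> nat \<Rightarrow> bool" where
  "append_step b N x y \<longleftrightarrow> (\<exists>t r. 1 \<le> t \<and> t \<le> N \<and> r < b ^ t \<and> y = b ^ t * x + r)"

text \<open>
  A finite or infinite walk \<open>M 0, M 1, \<dots>\<close> along the Fibonacci numbers with \<open>L\<close> steps;
  \<open>L = \<infinity>\<close> for an infinite walk. The values \<open>M j\<close> with \<open>j > L\<close> are irrelevant.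
\<close>

definition fib_walk :: "nat \<Rightarrow> nat \<Rightarrow> enat \<Rightarrow> (nat \<Rightarrow> nat) \<Rightarrow> bool" where
  "fib_walk b N L M \<longleftrightarrow>
     (\<forall>j. enat j \<le> L \<longrightarrow> M j \<in> range fib) \<and>
     (\<forall>j. enat j < L \<longrightarrow> append_step b N (M j) (M (Suc j)))"

text \<open>
  Since \<open>fib 0 = 0\<close> and leading zeros may be appended, \<open>0 \<rightarrow> 0\<close> is a legal step, and
  walks made of such steps can be arbitrarily long. Bounds on the number of steps
  therefore concern walks that never make this idle step; any walk from a positive
  Fibonacci number is of this kind.
\<close>

definition idles_at_zero :: "enat \<Rightarrow> (nat \<Rightarrow> nat) \<Rightarrow> bool" where
  "idles_at_zero L M \<longleftrightarrow> (\<exists>j. enat j < L \<and> M j = 0 \<and> M (Suc j) = 0)"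

definition K :: "nat \<Rightarrow> nat \<Rightarrow> int" where
  "K b N = \<lceil>1 + log phi (2 * real b ^ N)\<rceil>"

definition n_star :: "nat \<Rightarrow> nat \<Rightarrow> nat" where
  "n_star b N = Max {n. fib n \<le> b ^ N - 1}"

end

theory Submission
  imports Defs
begin

text \<open>
  With \<open>L\<^sub>k\<close> the Lucas numbers, \<open>F\<^bsub>m+k\<^esub> = L\<^sub>k F\<^sub>m - (-1)\<^sup>k F\<^bsub>m-k\<^esub>\<close>. A step from \<open>F\<^sub>m\<close> to \<open>F\<^bsub>m+k\<^esub>\<close>
  appending \<open>t\<close> digits has \<open>k \<le> K\<close> by the growth of the Fibonacci numbers, and its remainder is
  \<open>(L\<^sub>k - b\<^sup>t) F\<^sub>m - (-1)\<^sup>k F\<^bsub>m-k\<^esub>\<close>. If \<open>m - k > n\<^sub>*\<close>, this is either negative or at least \<open>b\<^sup>N\<close>,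
  according to the sign of \<open>L\<^sub>k - b\<^sup>t\<close> and the parity of \<open>k\<close>. A walk that never idles at zero is
  strictly increasing, so after \<open>j \<ge> 1\<close> steps it has reached at least \<open>F\<^bsub>j+1\<^esub>\<close>.
\<close>

text \<open>Here \<open>2 F\<^bsub>k+1\<^esub> - F\<^sub>k\<close> is the Lucas number \<open>L\<^sub>k\<close>, written so that \<open>k = 0\<close> is included.\<close>

lemma fib_lucas_reflection:
  "int (fib (a + 2 * k)) + (-1) ^ k * int (fib a)
     = (2 * int (fib (Suc k)) - int (fib k)) * int (fib (a + k))"
proof (induction a rule: fib.induct)
  case 1
  show ?case
    using fib_rec_even'[of k] by (cases k) (simp_all add: algebra_simps)
next
  \<comment> \<open>For \<open>a = 1\<close> the formula for \<open>fib (2 * k + 1)\<close> leaves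
    \<open>F_(k+1)^2 - F_k F_(k+1) - F_k^2 = (-1)^k\<close>, which is Cassini's identity. In the
    remaining case both sides obey the Fibonacci recurrence in \<open>a\<close>.\<close>
  case 2
  show ?case
    using fib_rec_odd[of k] fib_Cassini_int[of k]
    by (simp add: power2_eq_square algebra_simps)
next
  case (3 a)
  then show ?case by (simp add: algebra_simps)
qed

section \<open>The golden ratio and the growth of the Fibonacci numbers\<close>

lemma phi_gt_1: "phi > 1"
  unfolding phi_def using real_less_rsqrt[of 1 5] by simp

lemma phi_le_2: "phi \<le> 2"
  unfolding phi_def using real_le_lsqrt[of 3 5] by simp

lemma phi_square: "phi\<^sup>2 = phi + 1"
  by (simp add: phi_def power2_eq_square field_simps)

text \<open>By \<open>phi_square\<close> both sides satisfy the Fibonacci recurrence; the bases are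
  \<open>1 = fib 2\<close> and \<open>phi \<le> 2 = fib 3\<close>.\<close>

lemma fib_ge_phi_power: "phi ^ k \<le> real (fib (k + 2))"
proof (induction k rule: fib.induct)
  case 2
  then show ?case using phi_le_2 by (simp add: numeral_eq_Suc)
next
  case (3 k)
  have "phi ^ Suc (Suc k) = phi ^ k * phi\<^sup>2" by (simp add: power2_eq_square)
  also have "\<dots> = phi ^ Suc k + phi ^ k" by (simp add: phi_square algebra_simps)
  finally show ?case using 3 by simp
qed simp

lemma fib_unbounded: "\<exists>n. fib n > x"
proof -
  obtain k where "real x < phi ^ k" using real_arch_pow[OF phi_gt_1] by blast
  with fib_ge_phi_power[of k] have "real x < real (fib (k + 2))" by linarith
  then have "x < fib (k + 2)" by linarith
  then show ?thesis by blast
qed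

section \<open>The sizes of \<open>n_star\<close> and \<open>K\<close>\<close>

lemma finite_fib_le: "finite {n. fib n \<le> x}"
proof -
  obtain n0 where "fib n0 > x" using fib_unbounded by blast
  then have "{n. fib n \<le> x} \<subseteq> {..n0}"
    using fib_mono by (metis atMost_iff linorder_not_le mem_Collect_eq nle_le order_trans subsetI)
  then show ?thesis using finite_subset by blast
qed

lemma fib_n_star_le: "fib (n_star b N) \<le> b ^ N - 1"
  using Max_in[OF finite_fib_le[of "b ^ N - 1"]] unfolding n_star_def
  by (metis (mono_tags, lifting) empty_iff fib.simps(1) mem_Collect_eq zero_le)

lemma fib_gt_n_star:
  assumes "n > n_star b N"
  shows "fib n \<ge> b ^ N"
proof (rule ccontr)
  assume "\<not> ?thesis"
  then have "fib n \<le> b ^ N - 1" by simp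
  then have "n \<le> n_star b N" unfolding n_star_def by (intro Max_ge finite_fib_le) simp
  with assms show False by simp
qed

text \<open>Take logarithms in
  \<open>phi ^ (n_star b N - 2) \<le> fib (n_star b N) \<le> b ^ N\<close>.\<close>

lemma n_star_le_log:
  assumes "2 \<le> b"
  shows "real (n_star b N) \<le> real N * log phi (real b) + 2"
proof (cases "n_star b N \<ge> 2")
  case True
  then obtain k where k: "n_star b N = k + 2" by (metis le_add_diff_inverse2)
  have "phi ^ k \<le> real (fib (n_star b N))" using fib_ge_phi_power k by simp
  also have "\<dots> \<le> real b ^ N" using fib_n_star_le[of b N]
    by (metis diff_le_self le_trans of_nat_le_iff of_nat_power)
  finally have "log phi (phi ^ k) \<le> log phi (real b ^ N)"
    using phi_gt_1 assms by (subst log_le_cancel_iff) auto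
  then show ?thesis using phi_gt_1 assms k by (simp add: log_nat_power)
next
  case False
  have "0 \<le> real N * log phi (real b)" using phi_gt_1 assms by simp
  with False show ?thesis by linarith
qed

lemma log_phi_2_ge_1: "log phi 2 \<ge> 1"
  using phi_gt_1 phi_le_2 by simp

lemma log_K_arg:
  assumes "2 \<le> b"
  shows "log phi (2 * real b ^ N) = log phi 2 + real N * log phi (real b)"
  using phi_gt_1 assms by (simp add: log_mult log_nat_power)

lemma N_log_ge:
  assumes "2 \<le> b" "1 \<le> N"
  shows "log phi 2 \<le> real N * log phi (real b)"
proof -
  have "log phi 2 \<le> log phi (real b)" using phi_gt_1 assms by simp
  also have "\<dots> \<le> real N * log phi (real b)" using phi_gt_1 assms by simp
  finally show ?thesis .
qed

text \<open>Ensures \<open>m - 2 > n_star b N\<close> in \<open>no_step\<close>, and that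
  \<open>nat (K b N)\<close> loses nothing in \<open>fib_walk_length\<close>.\<close>

lemma K_ge_3:
  assumes "2 \<le> b" "1 \<le> N"
  shows "K b N \<ge> 3"
  using N_log_ge[OF assms] log_phi_2_ge_1 log_K_arg[OF assms(1), of N]
  unfolding K_def by linarith

text \<open>Of the constant 4, the index shift in \<open>n_star_le_log\<close> accounts for 2; the
  summand 1 in \<open>K\<close> and the rounding up cost at most 1 each.\<close>

lemma n_star_K_le:
  assumes "2 \<le> b"
  shows "real (n_star b N) + real_of_int (K b N) \<le> 2 * real N * log phi (real b) + log phi 2 + 4"
  using n_star_le_log[OF assms, of N] log_K_arg[OF assms, of N] unfolding K_def by linarith

section \<open>Single steps\<close>

text \<open>The addition formula gives \<open>fib (k + 1) * fib m \<le> fib (m + k) < b ^ t * (fib m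
  + 1) \<le> 2 * b ^ N * fib m\<close>. Cancel \<open>fib m\<close> and take logarithms, using
  \<open>phi ^ (k - 1) \<le> fib (k + 1)\<close>.\<close>

lemma step_gap_le_K:
  assumes b: "2 \<le> b" and k: "k \<ge> 1" and t: "t \<le> N" and r: "r < b ^ t" and m: "m \<ge> 1"
    and eq: "fib (m + k) = b ^ t * fib m + r"
  shows "int k \<le> K b N"
proof -
  obtain j where j: "k = Suc j" using k by (cases k) auto
  obtain m' where m': "m = Suc m'" using m by (cases m) auto
  have pos: "fib m > 0" using m by (simp add: fib_neq_0_nat)
  have "fib (k + 1) * fib m \<le> fib (m + k)"
    using fib_add[of m' k] m' by simp
  also have "\<dots> < b ^ t * fib m + b ^ t" using eq r by simp
  also have "\<dots> \<le> b ^ t * fib m + b ^ t * fib m" using pos by simp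
  also have "\<dots> \<le> (2 * b ^ N) * fib m"
    using power_increasing[OF t, of b] b by (simp add: mult_2[symmetric])
  finally have "fib (k + 1) < 2 * b ^ N" using pos by simp
  then have "real (fib (j + 2)) < 2 * real b ^ N"
    using j of_nat_less_iff[of "fib (j + 2)" "2 * b ^ N", where ?'a = real] by simp
  with fib_ge_phi_power[of j] have "phi ^ j < 2 * real b ^ N" by linarith
  then have "log phi (phi ^ j) < log phi (2 * real b ^ N)"
    using phi_gt_1 b by (subst log_less_cancel_iff) auto
  then have "real j < log phi (2 * real b ^ N)" using phi_gt_1 by simp
  then show ?thesis unfolding K_def using j by linarith
qed

lemma append_step_increasing:
  assumes "2 \<le> b" "append_step b N x y" "\<not> (x = 0 \<and> y = 0)"
  shows "x < y"
proof (cases "x = 0")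
  case False
  obtain t r where t: "1 \<le> t" "y = b ^ t * x + r"
    using assms(2) unfolding append_step_def by blast
  have "1 < b ^ t" using assms(1) t by (intro one_less_power) auto
  then have "x < b ^ t * x" using False by simp
  with t show ?thesis by linarith
qed (use assms in simp)

lemma no_step:
  assumes b: "2 \<le> b" and N: "1 \<le> N" and m: "int (n_star b N) + K b N + 1 \<le> int m"
    and t: "1 \<le> t" "t \<le> N" and r: "r < b ^ t"
  shows "fib n \<noteq> b ^ t * fib m + r"
proof
  assume eq: "fib n = b ^ t * fib m + r"
  have m4: "m \<ge> 4" "m - 2 > n_star b N" using m K_ge_3[OF b N] by linarith+
  have pos: "fib m > 0" using m4 by (simp add: fib_neq_0_nat)
  have "append_step b N (fib m) (fib n)" using t r eq unfolding append_step_def by blast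
  then have "fib m < fib n" using append_step_increasing[OF b] pos by simp
  then have "m < n" by (meson fib_mono linorder_not_le)
  then obtain k where k: "n = m + k" "k \<ge> 1" using less_iff_Suc_add by auto
  have "int k \<le> K b N"
    using step_gap_le_K[OF b k(2) t(2) r, of m] eq k m4 by simp
  \<comment> \<open>The lower bound on \<open>m\<close> keeps the reflected index
    \<open>m - k\<close> above \<open>n_star b N\<close>, so that
    \<open>fib (m - k) \<ge> b ^ N\<close>.\<close>
  then have km: "m > n_star b N + k" using m by linarith
  define a where "a = m - k"
  have a: "m = a + k" using km by (simp add: a_def)
  have an: "a > n_star b N" using a km by simp
  have bN: "b ^ t \<le> b ^ N" using b t by (simp add: power_increasing)
  have fa: "fib a > 0" using an by (simp add: fib_neq_0_nat)
  define l where "l = 2 * int (fib (Suc k)) - int (fib k)"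
  have "n = a + 2 * k" using a k by simp
  then have id: "int (fib n) + (-1) ^ k * int (fib a) = l * int (fib m)"
    using fib_lucas_reflection[of a k] a by (simp add: l_def)
  have "int (fib n) = int (b ^ t) * int (fib m) + int r" using eq by simp
  with id have rem: "int r = (l - int (b ^ t)) * int (fib m) - (-1) ^ k * int (fib a)"
    by (simp add: algebra_simps)
  \<comment> \<open>Since \<open>k \<ge> 1\<close>, \<open>fib m - fib a\<close> is at least
    \<open>fib m - fib (m - 1) = fib (m - 2)\<close>.\<close>
  define m' where "m' = m - 2"
  have m': "m = Suc (Suc m')" "m' > n_star b N" using m4 by (simp_all add: m'_def)
  have m'b: "fib m' \<ge> b ^ N" using fib_gt_n_star m' by simp
  have "a \<le> Suc m'" using a k m' by simp
  then have "fib a \<le> fib (Suc m')" by (rule fib_mono)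
  moreover have "fib m = fib (Suc m') + fib m'" using m' by simp
  ultimately have diff: "int (fib m) - int (fib a) \<ge> int (b ^ N)" using m'b by linarith
  have rb: "int r < int (b ^ N)" using r bN by linarith
  have sgn: "\<bar>(-1) ^ k * int (fib a)\<bar> = int (fib a)" by (simp add: abs_mult power_abs)
  \<comment> \<open>Whatever the parity of \<open>k\<close>, \<open>rem\<close> yields
    \<open>r \<ge> fib m - fib a \<ge> b ^ N\<close> in the first case and
    \<open>r \<le> fib a - fib m < 0\<close> in the third. In the second,
    \<open>r = fib a \<ge> b ^ N\<close> because \<open>r\<close> is nonnegative.\<close>
  consider "l - int (b ^ t) \<ge> 1" | "l = int (b ^ t)" | "l - int (b ^ t) \<le> -1" by linarith
  then show False
  proof cases
    case 1
    then have "1 * int (fib m) \<le> (l - int (b ^ t)) * int (fib m)"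
      by (intro mult_right_mono) auto
    then show False using rem sgn diff rb by linarith
  next
    case 2
    then have "int r = int (fib a)" using rem sgn fa by (simp add: abs_if split: if_splits)
    then show False using fib_gt_n_star[OF an] rb by linarith
  next
    case 3
    then have "(l - int (b ^ t)) * int (fib m) \<le> -1 * int (fib m)"
      by (intro mult_right_mono) auto
    then show False using rem sgn diff rb by linarith
  qed
qed

section \<open>Lengths of walks\<close>

lemma fib_less_imp_Suc_le: "fib i < fib j \<Longrightarrow> fib (Suc i) \<le> fib j"
  by (meson Suc_leI fib_mono linorder_not_le)

lemma fib_walk_increasing:
  assumes "2 \<le> b" "fib_walk b N L M" "\<not> idles_at_zero L M" "enat i < L"
  shows "M i < M (Suc i)"
  using append_step_increasing[OF assms(1)] assms(2-4)
  unfolding fib_walk_def idles_at_zero_def by blast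

text \<open>The first step reaches a positive value, hence at least \<open>fib 1 = fib 2\<close>;
  each later step moves the bound up one index. That coincidence gains the extra index used in
  \<open>fib_walk_length\<close>.\<close>

lemma fib_walk_ge:
  assumes b: "2 \<le> b" and w: "fib_walk b N L M" "\<not> idles_at_zero L M"
  shows "enat (Suc j) \<le> L \<Longrightarrow> fib (Suc (Suc j)) \<le> M (Suc j)"
proof (induction j)
  case 0
  then show ?case using fib_walk_increasing[OF b w, of 0] by (simp add: Suc_ile_eq)
next
  case (Suc j)
  have lt: "enat (Suc j) < L" using Suc.prems by (simp add: Suc_ile_eq)
  then have "fib (Suc (Suc j)) < M (Suc (Suc j))"
    using Suc.IH[OF less_imp_le[OF lt]] fib_walk_increasing[OF b w lt] by linarith
  moreover obtain i where "M (Suc (Suc j)) = fib i"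
    using w Suc.prems unfolding fib_walk_def by blast
  ultimately show ?case using fib_less_imp_Suc_le by metis
qed

lemma fib_walk_length:
  assumes b: "2 \<le> b" and N: "1 \<le> N" and w: "fib_walk b N L M" "\<not> idles_at_zero L M"
  shows "\<exists>l. L = enat l \<and> int l \<le> int (n_star b N) + K b N"
proof -
  define S where "S = n_star b N + nat (K b N)"
  have S: "int S = int (n_star b N) + K b N" "S \<ge> 3"
    using K_ge_3[OF b N] by (auto simp: S_def)
  have "L \<le> enat S"
  \<comment> \<open>A longer walk, finite or infinite, would take a step from
    \<open>M S = fib m\<close> with \<open>m > S\<close>, against \<open>no_step\<close>.\<close>
  proof (rule ccontr)
    assume "\<not> L \<le> enat S"
    then have lt: "enat S < L" by simp
    obtain j where j: "S = Suc j" using S by (cases S) auto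
    have "fib (Suc S) \<le> M S" using fib_walk_ge[OF b w, of j] lt j by simp
    moreover obtain m where m: "M S = fib m" using w lt unfolding fib_walk_def by force
    \<comment> \<open>Strict because \<open>S \<ge> 3\<close> avoids
      \<open>fib 1 = fib 2\<close>.\<close>
    moreover have "fib S < fib (Suc S)" using j S by (cases j) (auto simp: fib_neq_0_nat)
    ultimately have "fib S < fib m" by simp
    then have "S < m" by (meson fib_mono linorder_not_le)
    then have big: "int (n_star b N) + K b N + 1 \<le> int m" using S by linarith
    have "append_step b N (M S) (M (Suc S))" using w lt unfolding fib_walk_def by blast
    moreover obtain n where "M (Suc S) = fib n"
      using w lt unfolding fib_walk_def by (metis Suc_ile_eq imageE)
    ultimately show False
      using no_step[OF b N big] m unfolding append_step_def by metis
  qed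
  then obtain l where "L = enat l" "l \<le> S" by (cases L) auto
  then show ?thesis using S by auto
qed

theorem theorem3p1:
  shows "(\<forall>b N :: nat. 2 \<le> b \<longrightarrow> 1 \<le> N \<longrightarrow>
      (\<forall>m :: nat. int (n_star b N) + K b N + 1 \<le> int m \<longrightarrow>
         \<not> (\<exists>n t r :: nat. 1 \<le> t \<and> t \<le> N \<and> r < b ^ t \<and> fib n = b ^ t * fib m + r)) \<and>
      (\<forall>L M. fib_walk b N L M \<longrightarrow> \<not> idles_at_zero L M \<longrightarrow>
         (\<exists>l :: nat. L = enat l \<and> int l \<le> int (n_star b N) + K b N)) \<and>
      real (n_star b N) + real_of_int (K b N)
        \<le> 2 * real N * log phi (real b) + log phi 2 + 4) \<and>
    (\<exists>C :: real. \<forall>b N :: nat. 2 \<le> b \<longrightarrow> 1 \<le> N \<longrightarrow>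
      (\<forall>L M. fib_walk b N L M \<longrightarrow> \<not> idles_at_zero L M \<longrightarrow>
         (\<exists>l :: nat. L = enat l \<and> real l \<le> C * (real N * log phi (real b)))))"
proof (intro conjI)
  show "\<forall>b N :: nat. 2 \<le> b \<longrightarrow> 1 \<le> N \<longrightarrow>
      (\<forall>m :: nat. int (n_star b N) + K b N + 1 \<le> int m \<longrightarrow>
         \<not> (\<exists>n t r :: nat. 1 \<le> t \<and> t \<le> N \<and> r < b ^ t \<and> fib n = b ^ t * fib m + r)) \<and>
      (\<forall>L M. fib_walk b N L M \<longrightarrow> \<not> idles_at_zero L M \<longrightarrow>
         (\<exists>l :: nat. L = enat l \<and> int l \<le> int (n_star b N) + K b N)) \<and>
      real (n_star b N) + real_of_int (K b N)
        \<le> 2 * real N * log phi (real b) + log phi 2 + 4"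
    using no_step fib_walk_length n_star_K_le by blast
next
  \<comment> \<open>The constant is 7 = 2 + 1 + 4, as both \<open>log phi 2\<close> and 1 are at
    most \<open>N * log phi b\<close>.\<close>
  have "\<exists>l. L = enat l \<and> real l \<le> 7 * (real N * log phi (real b))"
    if b: "2 \<le> b" and N: "1 \<le> N" and w: "fib_walk b N L M" "\<not> idles_at_zero L M"
    for b N :: nat and L M
  proof -
    obtain l where l: "L = enat l" "int l \<le> int (n_star b N) + K b N"
      using fib_walk_length[OF b N w] by blast
    have "real l \<le> real (n_star b N) + real_of_int (K b N)" using l(2) by linarith
    then have "real l \<le> 7 * (real N * log phi (real b))"
      using n_star_K_le[OF b, of N] N_log_ge[OF b N] log_phi_2_ge_1 by linarith
    with l show ?thesis by blast
  qed
  then show "\<exists>C :: real. \<forall>b N :: nat. 2 \<le> b \<longrightarrow> 1 \<le> N \<longrightarrow>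
      (\<forall>L M. fib_walk b N L M \<longrightarrow> \<not> idles_at_zero L M \<longrightarrow>
         (\<exists>l :: nat. L = enat l \<and> real l \<le> C * (real N * log phi (real b))))"
    by blast
qed

end
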